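(* Let $A,B,C,D\in M_n(\mathbb{C})$ be arbitrary matrices and put $c_n:=n(n+1)(n+2)(n+3)$. Let $\sigma$ be the normalized surface (probability) measure on the unit sphere $\mathbb{S}^n$ of $\mathbb{C}^n$. Then \begin{align*} &c_n\int_{\mathbb{S}^n}\langle A\xi,\xi\rangle\langle B\xi,\xi\rangle\langle C\xi,\xi\rangle\langle D\xi,\xi\rangle\,d\sigma(\xi)=\\ &\ \mathrm{tr}\big[ABCD+ABDC+ACBD+ACDB+ADBC+ADCB\big]+\mathrm{tr}(A)\,\mathrm{tr}\big[BCD+BDC\big]\\ &+\mathrm{tr}(B)\,\mathrm{tr}\big[ACD+ADC\big]+\mathrm{tr}(C)\,\mathrm{tr}\big[ABD+ADB\big]+\mathrm{tr}(D)\,\mathrm{tr}\big[ABC+ACB\big]\\ &+\mathrm{tr}(AB)\big[\mathrm{tr}(CD)+\mathrm{tr}(C)\mathrm{tr}(D)\big]+\mathrm{tr}(AC)\big[\mathrm{tr}(BD)+\mathrm{tr}(B)\mathrm{tr}(D)\big]\\ &+\mathrm{tr}(AD)\big[\mathrm{tr}(BC)+\mathrm{tr}(B)\mathrm{tr}(C)\big]\\ &+\mathrm{tr}(A)\big[\mathrm{tr}(B)\mathrm{tr}(CD)+\mathrm{tr}(C)\mathrm{tr}(BD)+\mathrm{tr}(D)\mathrm{tr}(BC)\big]\\ &+\mathrm{tr}(A)\mathrm{tr}(B)\mathrm{tr}(C)\mathrm{tr}(D). \end{align*}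
   Context: $\mathbb{S}^n$ is the unit sphere of $\mathbb{C}^n$ (real dimension $2n-1$), $\sigma$ is the normalized Euclidean surface measure on it, $\langle\cdot,\cdot\rangle$ is the standard Hermitian inner product on $\mathbb{C}^n$, and $\mathrm{tr}$ is the (unnormalized) trace. *)

theory Defs
  imports "HOL-Analysis.Analysis"
begin

text \<open>
  The Hermitian inner product is linear in the first and conjugate-linear in the second argument,
  so that \<open>cvec_inner (A *v x) x\<close> depends linearly on the matrix \<open>A\<close>.
\<close>

definition cvec_inner :: "complex ^ 'n \<Rightarrow> complex ^ 'n \<Rightarrow> complex" where
  "cvec_inner x y = (\<Sum>i\<in>UNIV. x $ i * cnj (y $ i))"

text \<open>
  The Euclidean surface measure on the unit sphere of a Euclidean space of real dimension \<open>d\<close>,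
  defined by polar coordinates (Folland, \<open>Real Analysis\<close>, Theorem 2.49): the surface measure of a
  Borel set \<open>E\<close> of the sphere is \<open>d\<close> times the Lebesgue measure of the cone
  \<open>{r *\<^sub>R x | 0 < r < 1, x \<in> E}\<close>. That cone is the preimage of \<open>E\<close> under the radial projection
  of the punctured open unit ball; see \<open>emeasure_sphere_surface_measure\<close> below.
\<close>

definition sphere_surface_measure :: "'a::euclidean_space measure" where
  "sphere_surface_measure =
     scale_measure (of_nat DIM('a))
       (distr (restrict_space lborel (ball 0 1 - {0})) (restrict_space borel (sphere 0 1))
         (\<lambda>x. x /\<^sub>R norm x))"

definition normalized_sphere_measure :: "'a::euclidean_space measure" where
  "normalized_sphere_measure = uniform_measure sphere_surface_measure (sphere 0 1)"

lemma space_sphere_surface_measure: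
  "space (sphere_surface_measure :: 'a::euclidean_space measure) = sphere 0 1"
  by (simp add: sphere_surface_measure_def space_restrict_space space_scale_measure)

lemma sets_sphere_surface_measure:
  "sets (sphere_surface_measure :: 'a::euclidean_space measure)
     = sets (restrict_space borel (sphere 0 1))"
  by (simp add: sphere_surface_measure_def)

lemma emeasure_sphere_surface_measure:
  fixes E :: "'a::euclidean_space set"
  assumes "E \<in> sets borel" "E \<subseteq> sphere 0 1"
  shows "emeasure sphere_surface_measure E =
           of_nat DIM('a) * emeasure lborel {r *\<^sub>R x | r x. 0 < r \<and> r < 1 \<and> x \<in> E}"
proof -
  let ?B = "ball 0 1 - {0} :: 'a set"
  let ?f = "\<lambda>x::'a. x /\<^sub>R norm x"
  have f: "?f \<in> restrict_space lborel ?B \<rightarrow>\<^sub>M restrict_space borel (sphere 0 1)"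
  proof (rule measurable_restrict_space2)
    show "?f \<in> space (restrict_space lborel ?B) \<rightarrow> sphere 0 1"
      by (auto simp: space_restrict_space)
    have "?f \<in> borel \<rightarrow>\<^sub>M borel" by measurable
    then have "?f \<in> lborel \<rightarrow>\<^sub>M borel" by simp
    then show "?f \<in> restrict_space lborel ?B \<rightarrow>\<^sub>M borel" by (rule measurable_restrict_space1)
  qed
  have E: "E \<in> sets (restrict_space borel (sphere 0 1))"
    using assms by (simp add: sets_restrict_space_iff)
  have "?f -` E \<inter> ?B = {r *\<^sub>R x | r x. 0 < r \<and> r < 1 \<and> x \<in> E}" (is "?L = ?R")
  proof (intro subset_antisym subsetI)
    fix y assume "y \<in> ?L"
    then have "y = norm y *\<^sub>R ?f y" "0 < norm y" "norm y < 1" "?f y \<in> E" by auto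
    then show "y \<in> ?R" by blast
  next
    fix y assume "y \<in> ?R"
    then obtain r x where "y = r *\<^sub>R x" "0 < r" "r < 1" "x \<in> E" by blast
    moreover from this have "norm x = 1" using assms by auto
    ultimately show "y \<in> ?L" by auto
  qed
  moreover have "emeasure (distr (restrict_space lborel ?B) (restrict_space borel (sphere 0 1)) ?f) E
      = emeasure lborel (?f -` E \<inter> ?B)"
    by (subst emeasure_distr[OF f E], subst emeasure_restrict_space)
       (auto simp: space_restrict_space)
  ultimately show ?thesis by (simp add: sphere_surface_measure_def)
qed

lemma emeasure_sphere_surface_measure_total:
  "emeasure sphere_surface_measure (sphere 0 1 :: 'a::euclidean_space set) =
     ennreal (DIM('a) * unit_ball_vol DIM('a))"
proof -
  have "{r *\<^sub>R x | r x. 0 < r \<and> r < 1 \<and> x \<in> sphere 0 1} = ball 0 1 - {0::'a}" (is "?R = ?L")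
  proof (intro subset_antisym subsetI)
    fix y assume "y \<in> ?L"
    then have "y = norm y *\<^sub>R (y /\<^sub>R norm y)" "0 < norm y" "norm y < 1" "y /\<^sub>R norm y \<in> sphere 0 1"
      by auto
    then show "y \<in> ?R" by blast
  qed auto
  moreover have "emeasure lborel (ball 0 1 - {0::'a}) = emeasure lborel (ball 0 1 :: 'a set)"
    by (subst emeasure_Diff) auto
  ultimately show ?thesis
    by (simp add: emeasure_sphere_surface_measure emeasure_ball ennreal_mult' ennreal_of_nat_eq_real_of_nat)
qed

lemma emeasure_normalized_sphere_measure_total:
  "emeasure normalized_sphere_measure (sphere 0 1 :: 'a::euclidean_space set) = 1"
  unfolding normalized_sphere_measure_def
  by (rule emeasure_uniform_measure_1)
     (simp_all add: emeasure_sphere_surface_measure_total less_imp_neq[OF unit_ball_vol_pos, symmetric])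

end

theory Submission
  imports Defs
begin

text \<open>
  The measure is invariant under the one-parameter groups of phase rotations about a unit vector.
  Differentiating \<open>\<integral> \<Prod>\<^sub>k \<langle>B\<^sub>k \<xi>, \<xi>\<rangle>\<close> along them and polarizing gives, for every matrix \<open>X\<close>,
  that replacing one factor \<open>B\<^sub>k\<close> by the commutator \<open>[B\<^sub>k, X]\<close> and summing over \<open>k\<close> yields \<open>0\<close>.
  Taking for \<open>X\<close> the matrix units, with one of the \<open>B\<^sub>k\<close> adapted to \<open>X\<close>, and using \<open>\<langle>\<xi>, \<xi>\<rangle> = 1\<close>
  produces the recursion
  \<open>(n + m) \<integral> \<langle>A \<xi>, \<xi>\<rangle> \<Prod>\<^sub>k \<langle>B\<^sub>k \<xi>, \<xi>\<rangle> = tr A \<integral> \<Prod>\<^sub>k \<langle>B\<^sub>k \<xi>, \<xi>\<rangle> + \<Sum>\<^sub>i \<integral> \<langle>B\<^sub>i A \<xi>, \<xi>\<rangle> \<Prod>\<^bsub>k \<noteq> i\<^esub> \<langle>B\<^sub>k \<xi>, \<xi>\<rangle>\<close>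
  over \<open>m\<close> factors \<open>B\<^sub>k\<close>, which determines all moments; the traces are matched by cyclicity.
\<close>

section \<open>Orthogonal invariance of Lebesgue measure\<close>

text \<open>
  Uniqueness of Haar measure: the double integral of \<open>1\<^sub>B(y) 1\<^sub>E(y + f x)\<close> over \<open>x\<close> and \<open>y\<close> is
  computed in both orders, where the unit ball \<open>B\<close> is symmetric and invariant under \<open>f\<close>.
\<close>

lemma lborel_distr_orthogonal:
  fixes f :: "'a::euclidean_space \<Rightarrow> 'a"
  assumes f: "orthogonal_transformation f"
  shows "distr lborel borel f = lborel"
proof (rule measure_eqI)
  fix E :: "'a set"
  assume "E \<in> sets (distr lborel borel f)"
  then have E[measurable]: "E \<in> sets borel" by simp
  define B :: "'a set" where "B = ball 0 1"
  have B[measurable]: "B \<in> sets borel" by (simp add: B_def)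
  have lin: "linear f" using f by (rule orthogonal_transformation_linear)
  have [measurable]: "f \<in> borel \<rightarrow>\<^sub>M borel"
    using linear_continuous_on[OF lin[unfolded linear_conv_bounded_linear]]
    by (rule borel_measurable_continuous_onI)
  \<comment> \<open>Surjectivity makes \<open>inv f\<close> a right inverse. With it, a translation
    by \<open>y\<close> after \<open>f\<close> becomes a translation by \<open>inv f y\<close>
    before \<open>f\<close>, to which \<open>shift\<close> applies.\<close>
  have inv: "f (inv f y) = y" for y
    using orthogonal_transformation_surj[OF f] by (simp add: surj_f_inv_f)
  have shift: "(\<integral>\<^sup>+x. g (c + x) \<partial>lborel) = (\<integral>\<^sup>+x. g x \<partial>lborel)"
    if [measurable]: "g \<in> borel_measurable borel" for g :: "'a \<Rightarrow> ennreal" and c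
    by (subst (2) lborel_distr_plus[of c, symmetric], subst nn_integral_distr) auto
  have "emeasure lborel B * emeasure (distr lborel borel f) E
      = (\<integral>\<^sup>+y. indicator B y * (\<integral>\<^sup>+x. indicator E (f x) \<partial>lborel) \<partial>lborel)"
  proof -
    have "emeasure (distr lborel borel f) E = (\<integral>\<^sup>+x. indicator E x \<partial>distr lborel borel f)"
      by simp
    also have "\<dots> = (\<integral>\<^sup>+x. indicator E (f x) \<partial>lborel)" by (subst nn_integral_distr) auto
    finally show ?thesis by (subst nn_integral_multc) auto
  qed
  also have "\<dots> = (\<integral>\<^sup>+y. (\<integral>\<^sup>+x. indicator B y * indicator E (y + f x) \<partial>lborel) \<partial>lborel)"
  proof (rule nn_integral_cong)
    fix y
    have "(\<integral>\<^sup>+x. indicator E (f x) \<partial>lborel) = (\<integral>\<^sup>+x. indicator E (f (inv f y + x)) \<partial>lborel)"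
      by (rule shift[symmetric]) measurable
    also have "\<dots> = (\<integral>\<^sup>+x. indicator E (y + f x) \<partial>lborel)"
      by (simp add: linear_add[OF lin] inv)
    finally show "indicator B y * (\<integral>\<^sup>+x. indicator E (f x) \<partial>lborel)
        = (\<integral>\<^sup>+x. indicator B y * indicator E (y + f x) \<partial>lborel)"
      by (simp add: nn_integral_cmult)
  qed
  also have "\<dots> = (\<integral>\<^sup>+x. (\<integral>\<^sup>+y. indicator B y * indicator E (y + f x) \<partial>lborel) \<partial>lborel)"
    by (rule lborel_pair.Fubini') measurable
  also have "\<dots> = (\<integral>\<^sup>+x. (\<integral>\<^sup>+y. indicator B (y - f x) * indicator E y \<partial>lborel) \<partial>lborel)"
  proof (rule nn_integral_cong)
    fix x
    show "(\<integral>\<^sup>+y. indicator B y * indicator E (y + f x) \<partial>lborel)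
        = (\<integral>\<^sup>+y. indicator B (y - f x) * indicator E y \<partial>lborel)"
      using shift[of "\<lambda>y. indicator B (y - f x) * indicator E y" "f x"] by (simp add: add.commute)
  qed
  also have "\<dots> = (\<integral>\<^sup>+y. (\<integral>\<^sup>+x. indicator B (y - f x) * indicator E y \<partial>lborel) \<partial>lborel)"
    by (rule lborel_pair.Fubini') measurable
  also have "\<dots> = (\<integral>\<^sup>+y. emeasure lborel B * indicator E y \<partial>lborel)"
  proof (rule nn_integral_cong)
    fix y
    \<comment> \<open>Here \<open>y - f x = f (inv f y - x)\<close>, so isometry removes
      \<open>f\<close> and the symmetry of the norm flips the sign. This is where the shape of the
      ball enters.\<close>
    have "norm (y - f x) = norm (- inv f y + x)" for x
      using orthogonal_transformation_norm[OF f, of "inv f y - x"]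
      by (simp add: linear_diff[OF lin] inv norm_minus_commute)
    then have "indicator B (y - f x) = (indicator B (- inv f y + x) :: ennreal)" for x
      by (simp add: B_def indicator_def)
    then have "(\<integral>\<^sup>+x. indicator B (y - f x) \<partial>lborel) = emeasure lborel B"
      using shift[of "indicator B" "- inv f y"] by simp
    then show "(\<integral>\<^sup>+x. indicator B (y - f x) * indicator E y \<partial>lborel) = emeasure lborel B * indicator E y"
      by (subst nn_integral_multc) auto
  qed
  also have "\<dots> = emeasure lborel B * emeasure lborel E" by (subst nn_integral_cmult) auto
  finally have "emeasure lborel B * emeasure (distr lborel borel f) E
      = emeasure lborel B * emeasure lborel E" .
  \<comment> \<open>Cancellation in the extended nonnegative reals requires a factor that is neither
    zero nor infinite.\<close>
  moreover have "emeasure lborel B \<noteq> 0" "emeasure lborel B \<noteq> \<infinity>"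
    by (simp_all add: B_def emeasure_ball less_imp_neq[OF unit_ball_vol_pos, symmetric])
  ultimately show "emeasure (distr lborel borel f) E = emeasure lborel E"
    by (simp add: ennreal_mult_cancel_left)
qed simp

section \<open>Orthogonal invariance and integrability for the sphere measure\<close>

lemma sets_normalized_sphere_measure:
  "sets (normalized_sphere_measure :: 'a::euclidean_space measure)
     = sets (restrict_space borel (sphere 0 1))"
  by (simp add: normalized_sphere_measure_def sets_sphere_surface_measure)

lemma space_normalized_sphere_measure:
  "space (normalized_sphere_measure :: 'a::euclidean_space measure) = sphere 0 1"
  by (simp add: normalized_sphere_measure_def space_sphere_surface_measure)

lemma finite_measure_normalized_sphere_measure:
  "finite_measure (normalized_sphere_measure :: 'a::euclidean_space measure)"
  by standard (simp add: space_normalized_sphere_measure emeasure_normalized_sphere_measure_total)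

lemma measurable_normalized_sphere_measure:
  assumes "continuous_on (UNIV :: 'a::euclidean_space set) f"
  shows "f \<in> borel_measurable (normalized_sphere_measure :: 'a measure)"
  unfolding measurable_cong_sets[OF sets_normalized_sphere_measure refl]
  by (rule measurable_restrict_space1[OF borel_measurable_continuous_onI[OF assms]])

text \<open>A linear isometry commutes with forming cones: the cone over the preimage of
  \<open>E\<close> is the preimage of the cone over \<open>E\<close>. Invariance of Lebesgue measure
  therefore passes to the surface measure, and normalization divides both sides by the same total
  mass.\<close>

lemma distr_normalized_sphere_measure_orthogonal:
  fixes f :: "'a::euclidean_space \<Rightarrow> 'a"
  assumes f: "orthogonal_transformation f"
  shows "distr normalized_sphere_measure normalized_sphere_measure f = normalized_sphere_measure"
    and "f \<in> normalized_sphere_measure \<rightarrow>\<^sub>M normalized_sphere_measure"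
proof -
  have lin: "linear f" using f by (rule orthogonal_transformation_linear)
  have cont: "continuous_on UNIV f"
    using linear_continuous_on[OF lin[unfolded linear_conv_bounded_linear]] .
  have fb[measurable]: "f \<in> borel \<rightarrow>\<^sub>M borel" by (rule borel_measurable_continuous_onI[OF cont])
  have fn: "norm (f x) = norm x" for x using f by (rule orthogonal_transformation_norm)
  have f0: "f x = 0 \<longleftrightarrow> x = 0" for x using fn[of x] by (metis norm_eq_zero)
  have "f \<in> restrict_space borel (sphere 0 1) \<rightarrow>\<^sub>M restrict_space borel (sphere 0 1)"
    by (rule measurable_restrict_space2)
       (auto simp: space_restrict_space fn intro: measurable_restrict_space1)
  then show m: "f \<in> normalized_sphere_measure \<rightarrow>\<^sub>M normalized_sphere_measure"
    unfolding measurable_cong_sets[OF sets_normalized_sphere_measure sets_normalized_sphere_measure] .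
  show "distr normalized_sphere_measure normalized_sphere_measure f = normalized_sphere_measure"
  proof (rule measure_eqI)
    fix E assume "E \<in> sets (distr normalized_sphere_measure normalized_sphere_measure f)"
    then have E': "E \<in> sets normalized_sphere_measure" by simp
    then have E[measurable]: "E \<in> sets borel" and ES: "E \<subseteq> sphere 0 1"
      by (auto simp: sets_normalized_sphere_measure sets_restrict_space_iff)
    let ?cone = "\<lambda>E::'a set. {r *\<^sub>R x | r x. 0 < r \<and> r < 1 \<and> x \<in> E}"
    \<comment> \<open>Describing the cone by the radial projection makes it visibly Borel and lets
      norm preservation be applied pointwise.\<close>
    have cone_eq: "?cone F = {y. 0 < norm y \<and> norm y < 1 \<and> y /\<^sub>R norm y \<in> F}"
      if "F \<subseteq> sphere 0 1" for F
    proof (intro subset_antisym subsetI)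
      fix y assume "y \<in> {y. 0 < norm y \<and> norm y < 1 \<and> y /\<^sub>R norm y \<in> F}"
      then have "y = norm y *\<^sub>R (y /\<^sub>R norm y)" "0 < norm y" "norm y < 1" "y /\<^sub>R norm y \<in> F" by auto
      then show "y \<in> ?cone F" by blast
    next
      fix y assume "y \<in> ?cone F"
      then obtain r x where "y = r *\<^sub>R x" "0 < r" "r < 1" "x \<in> F" by blast
      moreover from this have "norm x = 1" using that by auto
      ultimately show "y \<in> {y. 0 < norm y \<and> norm y < 1 \<and> y /\<^sub>R norm y \<in> F}" by auto
    qed
    have fE: "f -` E \<subseteq> sphere 0 1" using ES fn by auto
    have "f -` E \<in> sets borel" using measurable_sets[OF fb E] by simp
    have "?cone (f -` E) = f -` ?cone E"
      unfolding cone_eq[OF fE] cone_eq[OF ES] by (simp add: fn f0 linear_cmul[OF lin] vimage_def)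
    moreover have "?cone E \<in> sets borel"
      unfolding cone_eq[OF ES] by measurable
    ultimately have "emeasure lborel (?cone (f -` E)) = emeasure (distr lborel borel f) (?cone E)"
      by (simp add: emeasure_distr)
    then have *: "emeasure sphere_surface_measure (f -` E) = emeasure sphere_surface_measure E"
      using fE ES \<open>f -` E \<in> sets borel\<close>
      by (simp add: emeasure_sphere_surface_measure lborel_distr_orthogonal[OF f])
    have S: "sphere 0 1 \<in> sets (sphere_surface_measure :: 'a measure)"
      by (simp add: sets_sphere_surface_measure sets_restrict_space_iff)
    have "emeasure (distr normalized_sphere_measure normalized_sphere_measure f) E
        = emeasure normalized_sphere_measure (f -` E)"
      using fE by (subst emeasure_distr[OF m E']) (simp add: space_normalized_sphere_measure Int_absorb2)
    also have "\<dots> = emeasure normalized_sphere_measure E"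
      using S E ES fE \<open>f -` E \<in> sets borel\<close> unfolding normalized_sphere_measure_def
      by (simp add: emeasure_uniform_measure sets_sphere_surface_measure sets_restrict_space_iff
          Int_absorb1 *)
    finally show "emeasure (distr normalized_sphere_measure normalized_sphere_measure f) E
        = emeasure normalized_sphere_measure E" .
  qed simp
qed

lemma integral_normalized_sphere_measure_orthogonal:
  fixes f :: "'a::euclidean_space \<Rightarrow> 'a" and g :: "'a \<Rightarrow> 'b::euclidean_space"
  assumes f: "orthogonal_transformation f" and g: "continuous_on UNIV g"
  shows "(LINT \<xi>|normalized_sphere_measure. g (f \<xi>)) = (LINT \<xi>|normalized_sphere_measure. g \<xi>)"
proof -
  have "(LINT \<xi>|normalized_sphere_measure. g (f \<xi>))
      = (LINT \<xi>|distr normalized_sphere_measure normalized_sphere_measure f. g \<xi>)"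
    by (rule integral_distr[symmetric, OF distr_normalized_sphere_measure_orthogonal(2)[OF f]
        measurable_normalized_sphere_measure[OF g]])
  then show ?thesis
    by (simp only: distr_normalized_sphere_measure_orthogonal(1)[OF f])
qed

text \<open>A continuous function is bounded on the compact sphere, and the measure is finite. This
  settles every integrability question below.\<close>

lemma integrable_normalized_sphere_measure:
  fixes f :: "'a::euclidean_space \<Rightarrow> 'b::euclidean_space"
  assumes "continuous_on UNIV f"
  shows "integrable normalized_sphere_measure f"
proof -
  have "compact (f ` sphere 0 1)"
    by (intro compact_continuous_image continuous_on_subset[OF assms]) auto
  then obtain C where "\<forall>y\<in>f ` sphere 0 1. norm y \<le> C"
    using compact_imp_bounded[of "f ` sphere 0 1"] unfolding bounded_iff by metis
  then have C: "norm (f x) \<le> C" if "x \<in> sphere 0 1" for x using that by blast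
  have "AE x in normalized_sphere_measure. norm (f x) \<le> C"
    by (rule AE_I2) (use C in \<open>simp add: space_normalized_sphere_measure\<close>)
  then show ?thesis
    using measurable_normalized_sphere_measure[OF assms]
    by (rule finite_measure.integrable_const_bound[OF finite_measure_normalized_sphere_measure])
qed

section \<open>Algebra, bounds and continuity of the Hermitian form\<close>

lemma cvec_inner_add_left: "cvec_inner (x + y) z = cvec_inner x z + cvec_inner y z"
  by (simp add: cvec_inner_def algebra_simps sum.distrib)

lemma cvec_inner_add_right: "cvec_inner z (x + y) = cvec_inner z x + cvec_inner z y"
  by (simp add: cvec_inner_def algebra_simps sum.distrib)

lemma cvec_inner_smult_left: "cvec_inner (c *s x) y = c * cvec_inner x y"
  by (simp add: cvec_inner_def sum_distrib_left mult.assoc)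

lemma cvec_inner_smult_right: "cvec_inner x (c *s y) = cnj c * cvec_inner x y"
  by (simp add: cvec_inner_def sum_distrib_left mult_ac)

lemma cnj_cvec_inner: "cnj (cvec_inner x y) = cvec_inner y x"
  by (simp add: cvec_inner_def mult.commute)

lemma cvec_inner_axis_left: "cvec_inner (axis a 1) x = cnj (x $ a)"
  by (simp add: cvec_inner_def axis_def if_distrib[of "\<lambda>z. z * _"] cong: if_cong)

lemma cvec_inner_axis_right: "cvec_inner x (axis a 1) = x $ a"
  by (simp add: cvec_inner_def axis_def if_distrib cong: if_cong)

lemma cvec_inner_self: "cvec_inner x x = complex_of_real ((norm x)\<^sup>2)"
proof -
  have "(norm x)\<^sup>2 = (\<Sum>i\<in>UNIV. (cmod (x $ i))\<^sup>2)"
    by (simp add: norm_vec_def L2_set_def sum_nonneg)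
  then show ?thesis by (simp add: cvec_inner_def complex_norm_square del: of_real_power)
qed

lemma norm_cvec_inner_le: "cmod (cvec_inner x y) \<le> norm x * norm y"
proof -
  have "cmod (cvec_inner x y) \<le> (\<Sum>i\<in>UNIV. \<bar>cmod (x $ i)\<bar> * \<bar>cmod (y $ i)\<bar>)"
    unfolding cvec_inner_def by (rule order_trans[OF norm_sum]) (simp add: norm_mult)
  also have "\<dots> \<le> norm x * norm y"
    unfolding norm_vec_def by (rule L2_set_mult_ineq)
  finally show ?thesis .
qed

lemma scaleR_eq_smult: "r *\<^sub>R x = complex_of_real r *s x"
  by (simp add: vec_eq_iff scaleR_conv_of_real[symmetric])

lemma norm_smult: "norm (c *s x) = cmod c * norm x"
  by (simp add: norm_vec_def norm_mult L2_set_right_distrib)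

lemma linear_matrix_vector_mult_complex: "linear ((*v) (A :: complex ^ 'n ^ 'm))"
  by (rule linearI) (simp_all add: matrix_vector_right_distrib scaleR_eq_smult vector_scalar_commute)

lemma matrix_vector_mult_bound:
  fixes A :: "complex ^ 'n ^ 'm"
  shows "\<exists>L\<ge>0. \<forall>x. norm (A *v x) \<le> L * norm x"
  using linear_bounded_pos[OF linear_matrix_vector_mult_complex[of A]] by (metis less_imp_le)

lemma continuous_on_cvec_inner [continuous_intros]:
  fixes f g :: "'a::topological_space \<Rightarrow> complex ^ 'n"
  assumes "continuous_on S f" "continuous_on S g"
  shows "continuous_on S (\<lambda>x. cvec_inner (f x) (g x))"
  unfolding cvec_inner_def by (intro continuous_intros assms)

lemma continuous_on_matrix_vector_mult [continuous_intros]: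
  fixes A :: "complex ^ 'n ^ 'm"
  assumes "continuous_on S f"
  shows "continuous_on S (\<lambda>x. A *v f x)"
  unfolding matrix_vector_mult_def by (intro continuous_intros assms)

text \<open>Dividing all factors by \<open>C\<close> moves them into the closed unit disc, where
  \<open>norm_prod_diff\<close> bounds a difference of products by the sum of the differences of the
  factors. It serves to dominate difference quotients of products of forms.\<close>

lemma norm_prod_diff_le:
  fixes z w :: "'i \<Rightarrow> complex"
  assumes K: "finite K" and C: "C > 0"
    and "\<And>k. k \<in> K \<Longrightarrow> cmod (z k) \<le> C" "\<And>k. k \<in> K \<Longrightarrow> cmod (w k) \<le> C"
  shows "cmod ((\<Prod>k\<in>K. z k) - (\<Prod>k\<in>K. w k)) \<le> C ^ card K * (\<Sum>k\<in>K. cmod (z k - w k) / C)"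
proof -
  have "(\<Prod>k\<in>K. z k) - (\<Prod>k\<in>K. w k)
      = of_real C ^ card K * ((\<Prod>k\<in>K. z k / of_real C) - (\<Prod>k\<in>K. w k / of_real C))"
    using C by (simp add: prod_dividef right_diff_distrib)
  then have "cmod ((\<Prod>k\<in>K. z k) - (\<Prod>k\<in>K. w k))
      = C ^ card K * cmod ((\<Prod>k\<in>K. z k / of_real C) - (\<Prod>k\<in>K. w k / of_real C))"
    using C by (simp add: norm_mult norm_power)
  also have "\<dots> \<le> C ^ card K * (\<Sum>k\<in>K. cmod (z k / of_real C - w k / of_real C))"
    using assms by (intro mult_left_mono norm_prod_diff) (auto simp: norm_divide)
  also have "(\<Sum>k\<in>K. cmod (z k / of_real C - w k / of_real C)) = (\<Sum>k\<in>K. cmod (z k - w k) / C)"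
    using C by (intro sum.cong) (auto simp: diff_divide_distrib[symmetric] norm_divide)
  finally show ?thesis .
qed

section \<open>Phase rotations about a unit vector\<close>

text \<open>For a unit vector \<open>v\<close> this is the unitary map that multiplies the component
  along \<open>v\<close> by \<open>cis t\<close> and fixes the orthogonal complement of
  \<open>v\<close>, that is, the one-parameter group generated by \<open>\<i>\<close> times the
  projection onto \<open>v\<close>.\<close>

definition phase_rotation :: "real \<Rightarrow> complex ^ 'n \<Rightarrow> complex ^ 'n \<Rightarrow> complex ^ 'n" where
  "phase_rotation t v x = x + ((cis t - 1) * cvec_inner x v) *s v"

lemma orthogonal_phase_rotation:
  assumes "norm v = 1"
  shows "orthogonal_transformation (phase_rotation t v)"
  unfolding orthogonal_transformation
proof (intro conjI allI)
  show "linear (phase_rotation t v)"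
    by (rule linearI)
       (simp_all add: phase_rotation_def scaleR_eq_smult cvec_inner_add_left cvec_inner_smult_left
         vec_eq_iff algebra_simps)
next
  fix x
  define w where "w = cis t - 1"
  define a where "a = cvec_inner x v"
  have a: "cvec_inner v x = cnj a" by (simp add: a_def cnj_cvec_inner)
  have v: "cvec_inner v v = 1" using assms by (simp add: cvec_inner_self)
  have "cvec_inner (phase_rotation t v x) (phase_rotation t v x)
      = cvec_inner x x + a * cnj a * (w + cnj w + w * cnj w)"
    unfolding phase_rotation_def w_def[symmetric] a_def[symmetric] cvec_inner_add_left
      cvec_inner_add_right cvec_inner_smult_left cvec_inner_smult_right a v
    by (simp add: a_def[symmetric] algebra_simps)
  \<comment> \<open>The change of the squared norm carries the factor
    \<open>(1 + w) * cnj (1 + w) - 1\<close>, and \<open>1 + w = cis t\<close> has modulus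
    one.\<close>
  also have "w + cnj w + w * cnj w = cis t * cnj (cis t) - 1"
    by (simp add: w_def algebra_simps)
  also have "\<dots> = 0" by (simp add: cis_cnj cis_mult)
  finally have "complex_of_real ((norm (phase_rotation t v x))\<^sup>2) = complex_of_real ((norm x)\<^sup>2)"
    by (simp only: cvec_inner_self) simp
  then have "(norm (phase_rotation t v x))\<^sup>2 = (norm x)\<^sup>2" by (simp only: of_real_eq_iff)
  then show "norm (phase_rotation t v x) = norm x" by simp
qed

text \<open>The chord \<open>cmod (cis t - 1)\<close> is at most the arc
  \<open>\<bar>t\<bar>\<close>. This Lipschitz estimate in \<open>t\<close> makes the difference
  quotients along the flow uniformly bounded.\<close>

lemma norm_phase_rotation_diff_le:
  assumes "norm v = 1"
  shows "norm (phase_rotation t v x - x) \<le> \<bar>t\<bar> * norm x"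
proof -
  have "cmod (cis t - 1) = 2 * \<bar>sin (t / 2)\<bar>"
    using dist_exp_i_1[of t] by (simp add: cis_conv_exp)
  also have "\<dots> \<le> \<bar>t\<bar>" using abs_sin_x_le_abs_x[of "t / 2"] by simp
  finally have "cmod (cis t - 1) \<le> \<bar>t\<bar>" .
  moreover have "cmod (cvec_inner x v) \<le> norm x" using norm_cvec_inner_le[of x v] assms by simp
  ultimately show ?thesis
    by (simp add: phase_rotation_def norm_smult norm_mult assms mult_mono)
qed

lemma continuous_on_phase_rotation [continuous_intros]:
  "continuous_on UNIV (phase_rotation t v)"
  unfolding phase_rotation_def cvec_inner_def vector_scalar_mult_def
  by (intro continuous_intros)

text \<open>
  The form along the flow involves \<open>cnj (cis t)\<close>; it is replaced by its holomorphic extension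
  \<open>exp (- \<i> z)\<close> so that complex derivatives apply.
\<close>

lemma cvec_inner_phase_rotation_deriv:
  fixes M :: "complex ^ 'n ^ 'n" and v x :: "complex ^ 'n"
  shows "\<exists>g. (\<forall>t. g (complex_of_real t)
            = cvec_inner (M *v phase_rotation t v x) (phase_rotation t v x)) \<and>
          (g has_field_derivative \<i> * (cvec_inner x v * cvec_inner (M *v v) x
            - cvec_inner v x * cvec_inner (M *v x) v)) (at 0)"
proof (intro exI conjI allI)
  let ?a = "cvec_inner x v" and ?b = "cvec_inner v x"
  \<comment> \<open>Sesquilinear expansion of the form at the rotated vector. The two middle terms
    give the derivative; the last one vanishes to second order at 0.\<close>
  let ?g = "\<lambda>z. cvec_inner (M *v x) x + (exp (\<i> * z) - 1) * ?a * cvec_inner (M *v v) x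
      + (exp (- (\<i> * z)) - 1) * ?b * cvec_inner (M *v x) v
      + (exp (\<i> * z) - 1) * (exp (- (\<i> * z)) - 1) * ?a * ?b * cvec_inner (M *v v) v"
  show "?g (complex_of_real t)
      = cvec_inner (M *v phase_rotation t v x) (phase_rotation t v x)" for t
  proof -
    have "exp (\<i> * complex_of_real t) = cis t" "exp (- (\<i> * complex_of_real t)) = cnj (cis t)"
      by (simp_all add: cis_conv_exp exp_cnj)
    then show ?thesis
      unfolding phase_rotation_def matrix_vector_right_distrib vector_scalar_commute
        cvec_inner_add_left cvec_inner_add_right cvec_inner_smult_left cvec_inner_smult_right
      by (simp add: cnj_cvec_inner algebra_simps)
  qed
  show "(?g has_field_derivative \<i> * (?a * cvec_inner (M *v v) x - ?b * cvec_inner (M *v x) v)) (at 0)"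
    by (auto intro!: derivative_eq_intros simp: algebra_simps)
qed

section \<open>Infinitesimal invariance of sphere means\<close>

abbreviation sphere_mean :: "(complex ^ 'n \<Rightarrow> complex) \<Rightarrow> complex" where
  "sphere_mean f \<equiv> (LINT \<xi>|normalized_sphere_measure. f \<xi>)"

text \<open>The mean of a product of forms is constant along the flow, so its difference quotients
  have mean zero. They converge pointwise to \<open>\<i>\<close> times the integrand by the product
  rule and are uniformly bounded on the sphere, so dominated convergence applies.\<close>

lemma sphere_mean_phase_derivative:
  fixes B :: "'k \<Rightarrow> complex ^ 'n ^ 'n" and v :: "complex ^ 'n"
  assumes K: "finite K" and v: "norm v = 1"
  shows "sphere_mean (\<lambda>\<xi>. \<Sum>i\<in>K.
      (cvec_inner \<xi> v * cvec_inner (B i *v v) \<xi> - cvec_inner v \<xi> * cvec_inner (B i *v \<xi>) v)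
      * (\<Prod>j\<in>K - {i}. cvec_inner (B j *v \<xi>) \<xi>)) = 0"
    (is "sphere_mean ?F = 0")
proof -
  define U where "U = (\<lambda>t::real. phase_rotation t v)"
  define P where "P = (\<lambda>\<xi>. \<Prod>k\<in>K. cvec_inner (B k *v \<xi>) \<xi>)"
  \<comment> \<open>Difference quotients along a sequence of times, as dominated convergence
    requires; \<open>Suc n\<close> keeps every time step nonzero.\<close>
  define s where "s = (\<lambda>(n::nat) \<xi>. (P (U (1 / Suc n) \<xi>) - P \<xi>) / complex_of_real (1 / Suc n))"
  have contU: "continuous_on UNIV (U t)" for t
    unfolding U_def by (rule continuous_on_phase_rotation)
  have contP: "continuous_on UNIV P" unfolding P_def by (intro continuous_intros)
  have contPU: "continuous_on UNIV (\<lambda>\<xi>. P (U t \<xi>))" for t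
    using continuous_on_compose2[OF contP contU] by simp
  have conts: "continuous_on UNIV (s n)" for n
    unfolding s_def by (intro continuous_intros contPU contP) (simp del: of_nat_Suc)
  have contF: "continuous_on UNIV ?F" by (intro continuous_intros)
  have U: "orthogonal_transformation (U t)" for t
    unfolding U_def using v by (rule orthogonal_phase_rotation)
  have normU: "norm (U t \<xi>) = norm \<xi>" for t \<xi> using U by (rule orthogonal_transformation_norm)

  have s0: "sphere_mean (s n) = 0" for n
  proof -
    have "sphere_mean (s n) = (sphere_mean (\<lambda>\<xi>. P (U (1 / Suc n) \<xi>)) - sphere_mean P)
        / complex_of_real (1 / Suc n)"
      unfolding s_def
      by (simp add: Bochner_Integration.integral_diff integrable_normalized_sphere_measure contPU contP
          del: of_real_divide)
    then show ?thesis by (simp add: integral_normalized_sphere_measure_orthogonal[OF U contP])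
  qed

  have lim: "(\<lambda>n. s n \<xi>) \<longlonglongrightarrow> \<i> * ?F \<xi>" for \<xi>
  proof -
    have "\<forall>k. \<exists>g. (\<forall>t. g (complex_of_real t) = cvec_inner (B k *v U t \<xi>) (U t \<xi>)) \<and>
        (g has_field_derivative \<i> * (cvec_inner \<xi> v * cvec_inner (B k *v v) \<xi>
            - cvec_inner v \<xi> * cvec_inner (B k *v \<xi>) v)) (at 0)"
      unfolding U_def by (intro allI cvec_inner_phase_rotation_deriv)
    then obtain g where g: "\<And>k t. g k (complex_of_real t) = cvec_inner (B k *v U t \<xi>) (U t \<xi>)"
      and g': "\<And>k. (g k has_field_derivative \<i> * (cvec_inner \<xi> v * cvec_inner (B k *v v) \<xi>
            - cvec_inner v \<xi> * cvec_inner (B k *v \<xi>) v)) (at 0)"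
      by metis
    have U0: "U 0 \<xi> = \<xi>" by (simp add: U_def phase_rotation_def)
    have g0: "g k 0 = cvec_inner (B k *v \<xi>) \<xi>" for k using g[of k 0] by (simp add: U0)
    have "((\<lambda>z. \<Prod>k\<in>K. g k z) has_derivative
        (\<lambda>y. \<Sum>i\<in>K. (\<i> * (cvec_inner \<xi> v * cvec_inner (B i *v v) \<xi>
            - cvec_inner v \<xi> * cvec_inner (B i *v \<xi>) v)) * y * (\<Prod>j\<in>K - {i}. g j 0))) (at 0)"
      using g' unfolding has_field_derivative_def by (intro has_derivative_prod)
    moreover have "(\<lambda>y. \<Sum>i\<in>K. (\<i> * (cvec_inner \<xi> v * cvec_inner (B i *v v) \<xi>
            - cvec_inner v \<xi> * cvec_inner (B i *v \<xi>) v)) * y * (\<Prod>j\<in>K - {i}. g j 0))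
        = (*) (\<i> * ?F \<xi>)"
      by (simp add: fun_eq_iff g0 sum_distrib_left sum_distrib_right mult_ac)
    ultimately have "((\<lambda>z. \<Prod>k\<in>K. g k z) has_field_derivative \<i> * ?F \<xi>) (at 0)"
      unfolding has_field_derivative_def by simp
    then have *: "((\<lambda>h. ((\<Prod>k\<in>K. g k h) - (\<Prod>k\<in>K. g k 0)) / h) \<longlongrightarrow> \<i> * ?F \<xi>) (at 0)"
      by (simp add: DERIV_def)
    \<comment> \<open>The complex derivative at 0 is sampled at the real times, where
      \<open>g\<close> agrees with the form along the flow.\<close>
    have "(\<lambda>n. complex_of_real (1 / Suc n)) \<longlonglongrightarrow> complex_of_real 0"
      by (intro tendsto_of_real LIMSEQ_Suc[OF lim_1_over_n])
    then have "filterlim (\<lambda>n. complex_of_real (1 / Suc n)) (at 0) sequentially"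
      by (simp add: filterlim_at del: of_real_divide)
    from filterlim_compose[OF * this]
    show ?thesis by (simp add: s_def P_def g g0 del: of_real_divide)
  qed

  have "\<forall>k. \<exists>L. 0 \<le> L \<and> (\<forall>x. norm (B k *v x) \<le> L * norm x)"
    using matrix_vector_mult_bound by blast
  from choice[OF this] obtain L where L: "\<And>k. L k \<ge> 0" "\<And>k x. norm (B k *v x) \<le> L k * norm x"
    by blast
  \<comment> \<open>One common bound for all forms on the sphere; the summand 1 keeps it positive,
    so that division by it is allowed.\<close>
  define C where "C = 1 + (\<Sum>k\<in>K. L k)"
  have C: "C > 0" unfolding C_def by (intro add_pos_nonneg sum_nonneg L) simp
  have LC: "L k \<le> C" if "k \<in> K" for k
    using member_le_sum[of k K L] that K L by (simp add: C_def)
  have form: "cmod (cvec_inner (B k *v x) y) \<le> L k * norm x * norm y" for k x y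
    using norm_cvec_inner_le[of "B k *v x" y] mult_right_mono[OF L(2)[of k x], of "norm y"] by simp
  have bound: "cmod (s n \<xi>) \<le> C ^ card K * (\<Sum>k\<in>K. 2 * L k / C)" if \<xi>: "norm \<xi> = 1" for n \<xi>
  proof -
    define t :: real where "t = 1 / Suc n"
    have t: "t > 0" by (simp add: t_def)
    have q: "cmod (cvec_inner (B k *v x) x) \<le> C" if "k \<in> K" "norm x = 1" for k x
      using form[of k x x] LC[of k] that by simp
    have d: "norm (U t \<xi> - \<xi>) \<le> t"
      using norm_phase_rotation_diff_le[OF v, of t \<xi>] t \<xi> by (simp add: U_def)
    have diff: "cmod (cvec_inner (B k *v U t \<xi>) (U t \<xi>) - cvec_inner (B k *v \<xi>) \<xi>) \<le> 2 * L k * t" for k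
    proof -
      obtain \<delta> where \<delta>: "U t \<xi> = \<xi> + \<delta>" by (metis add.commute diff_add_cancel)
      \<comment> \<open>Changing one argument of the form at a time leaves two terms, each
        containing \<open>\<delta>\<close> once, hence a bound linear in \<open>t\<close>.\<close>
      have "cvec_inner (B k *v U t \<xi>) (U t \<xi>) - cvec_inner (B k *v \<xi>) \<xi>
          = cvec_inner (B k *v \<delta>) (U t \<xi>) + cvec_inner (B k *v \<xi>) \<delta>"
        by (simp add: \<delta> matrix_vector_right_distrib cvec_inner_add_left cvec_inner_add_right)
      also have "cmod \<dots> \<le> L k * norm \<delta> + L k * norm \<delta>"
        using form[of k \<delta> "U t \<xi>"] form[of k \<xi> \<delta>]
        by (intro order_trans[OF norm_triangle_ineq] add_mono) (simp_all add: normU \<xi>)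
      also have "\<dots> \<le> 2 * L k * t"
        using mult_left_mono[of "norm \<delta>" t "L k"] d L(1)[of k] by (simp add: \<delta>)
      finally show ?thesis .
    qed
    have "cmod (P (U t \<xi>) - P \<xi>) \<le> C ^ card K *
        (\<Sum>k\<in>K. cmod (cvec_inner (B k *v U t \<xi>) (U t \<xi>) - cvec_inner (B k *v \<xi>) \<xi>) / C)"
      unfolding P_def by (intro norm_prod_diff_le K C q) (auto simp: normU \<xi>)
    also have "\<dots> \<le> C ^ card K * (\<Sum>k\<in>K. 2 * L k * t / C)"
      using C by (intro mult_left_mono sum_mono divide_right_mono diff) auto
    also have "\<dots> = (C ^ card K * (\<Sum>k\<in>K. 2 * L k / C)) * t"
      by (simp add: sum_distrib_right sum_distrib_left mult_ac)
    finally show ?thesis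
      using t unfolding s_def t_def[symmetric] by (simp add: norm_divide divide_le_eq)
  qed

  have "(\<lambda>n. sphere_mean (s n)) \<longlonglongrightarrow> sphere_mean (\<lambda>\<xi>. \<i> * ?F \<xi>)"
  proof (rule integral_dominated_convergence[where w = "\<lambda>_. C ^ card K * (\<Sum>k\<in>K. 2 * L k / C)"])
    show "(\<lambda>\<xi>. \<i> * ?F \<xi>) \<in> borel_measurable normalized_sphere_measure"
      by (intro measurable_normalized_sphere_measure continuous_intros)
    show "s n \<in> borel_measurable normalized_sphere_measure" for n
      by (intro measurable_normalized_sphere_measure conts)
    show "integrable normalized_sphere_measure (\<lambda>_::complex ^ 'n. C ^ card K * (\<Sum>k\<in>K. 2 * L k / C))"
      by (intro integrable_normalized_sphere_measure continuous_intros)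
    show "AE \<xi> in normalized_sphere_measure. (\<lambda>n. s n \<xi>) \<longlonglongrightarrow> \<i> * ?F \<xi>"
      using lim by simp
    show "AE \<xi> in normalized_sphere_measure. cmod (s n \<xi>) \<le> C ^ card K * (\<Sum>k\<in>K. 2 * L k / C)" for n
      by (rule AE_I2) (use bound in \<open>simp add: space_normalized_sphere_measure\<close>)
  qed
  then have "sphere_mean (\<lambda>\<xi>. \<i> * ?F \<xi>) = 0"
    using LIMSEQ_unique[OF _ tendsto_const] by (simp only: s0)
  then show ?thesis by simp
qed

text \<open>The case \<open>u = v\<close> extends to all \<open>u\<close> and \<open>v\<close> by polarization.\<close>

lemma sphere_mean_commutator:
  fixes B :: "'k \<Rightarrow> complex ^ 'n ^ 'n" and u v :: "complex ^ 'n"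
  assumes K: "finite K"
  shows "sphere_mean (\<lambda>\<xi>. \<Sum>i\<in>K.
      (cvec_inner \<xi> v * cvec_inner (B i *v u) \<xi> - cvec_inner u \<xi> * cvec_inner (B i *v \<xi>) v)
      * (\<Prod>j\<in>K - {i}. cvec_inner (B j *v \<xi>) \<xi>)) = 0"
proof -
  define R where "R = (\<lambda>u v \<xi>. \<Sum>i\<in>K.
      (cvec_inner \<xi> v * cvec_inner (B i *v u) \<xi> - cvec_inner u \<xi> * cvec_inner (B i *v \<xi>) v)
      * (\<Prod>j\<in>K - {i}. cvec_inner (B j *v \<xi>) \<xi>))"
  define T where "T = (\<lambda>u v. sphere_mean (R u v))"
  have int: "integrable normalized_sphere_measure (R u v)" for u v
    unfolding R_def by (intro integrable_normalized_sphere_measure continuous_intros)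
  have "R (u + u') v = (\<lambda>\<xi>. R u v \<xi> + R u' v \<xi>)" for u u' v
    by (simp add: R_def fun_eq_iff matrix_vector_right_distrib cvec_inner_add_left
        sum.distrib[symmetric] algebra_simps)
  then have add_left: "T (u + u') v = T u v + T u' v" for u u' v
    by (simp add: T_def int)
  have "R u (v + v') = (\<lambda>\<xi>. R u v \<xi> + R u v' \<xi>)" for u v v'
    by (simp add: R_def fun_eq_iff cvec_inner_add_right sum.distrib[symmetric] algebra_simps)
  then have add_right: "T u (v + v') = T u v + T u v'" for u v v'
    by (simp add: T_def int)
  have "R (c *s u) v = (\<lambda>\<xi>. c * R u v \<xi>)" for c u v
    by (simp add: R_def fun_eq_iff vector_scalar_commute cvec_inner_smult_left
        sum_distrib_left algebra_simps)
  then have smult_left: "T (c *s u) v = c * T u v" for c u v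
    by (simp add: T_def)
  have "R u (c *s v) = (\<lambda>\<xi>. cnj c * R u v \<xi>)" for c u v
    by (simp add: R_def fun_eq_iff cvec_inner_smult_right sum_distrib_left algebra_simps)
  then have smult_right: "T u (c *s v) = cnj c * T u v" for c u v
    by (simp add: T_def)
  \<comment> \<open>The derivative lemma speaks of unit vectors, so a nonzero \<open>v\<close> is
    normalized and its norm is pulled out of both arguments.\<close>
  have diag: "T v v = 0" for v
  proof (cases "v = 0")
    case True
    then have "T v v = T (0 *s v) v" by simp
    then show ?thesis by (simp only: smult_left mult_zero_left)
  next
    case False
    define e where "e = v /\<^sub>R norm v"
    have "norm e = 1" using False by (simp add: e_def)
    then have "T e e = 0" unfolding T_def R_def by (rule sphere_mean_phase_derivative[OF K])
    moreover have "v = complex_of_real (norm v) *s e"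
      using False by (simp add: e_def flip: scaleR_eq_smult)
    ultimately show ?thesis by (metis smult_left smult_right mult_zero_right)
  qed
  have "T u v + T v u = 0"
    using diag[of "u + v"] diag[of u] diag[of v] by (simp add: add_left add_right add.commute)
  \<comment> \<open>By conjugate linearity in the second argument, the cross terms at
    \<open>u + \<i> *s v\<close> are \<open>- \<i> * T u v + \<i> * T v u\<close>.\<close>
  moreover have "T u v - T v u = 0"
    using diag[of "u + \<i> *s v"] diag[of u] diag[of v] by (simp add: add_left add_right smult_left smult_right)
  ultimately have "2 * T u v = 0" by algebra
  then show ?thesis by (simp add: T_def R_def)
qed

section \<open>The moment recursion\<close>

lemma matrix_vector_mult_axis_nth: "(M *v axis a 1) $ i = M $ i $ a" for M :: "complex ^ 'n ^ 'm"
  by (simp add: matrix_vector_mult_def axis_def if_distrib cong: if_cong)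

text \<open>Expansion of \<open>y\<close> in the standard basis. With \<open>y = A *v \<xi>\<close>
  it contracts the sum over \<open>a\<close> in the recursion to the form of a matrix
  product.\<close>

lemma sum_cvec_inner_axis:
  "(\<Sum>a\<in>UNIV. y $ a * cvec_inner (M *v axis a 1) x) = cvec_inner (M *v y) x"
proof -
  have "(\<Sum>a\<in>UNIV. y $ a * cvec_inner (M *v axis a 1) x)
      = (\<Sum>a\<in>UNIV. \<Sum>i\<in>UNIV. M $ i $ a * y $ a * cnj (x $ i))"
    by (simp add: cvec_inner_def matrix_vector_mult_axis_nth sum_distrib_left mult_ac)
  also have "\<dots> = cvec_inner (M *v y) x"
    by (subst sum.swap) (simp add: cvec_inner_def matrix_vector_mult_def sum_distrib_right)
  finally show ?thesis .
qed

text \<open>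
  The infinitesimal invariance is summed over \<open>u = e\<^sub>a\<close>, \<open>v = e\<^sub>b\<close>, with \<open>B s\<close> replaced by the
  matrix \<open>P a b\<close> whose row \<open>b\<close> is the row \<open>a\<close> of \<open>B s\<close> and whose other rows vanish.
\<close>

lemma sphere_mean_recursion:
  fixes B :: "'k \<Rightarrow> complex ^ 'n ^ 'n"
  assumes K: "finite K" and s: "s \<notin> K"
  shows "of_nat (CARD('n) + card K) * sphere_mean (\<lambda>\<xi>. \<Prod>k\<in>insert s K. cvec_inner (B k *v \<xi>) \<xi>)
    = trace (B s) * sphere_mean (\<lambda>\<xi>. \<Prod>k\<in>K. cvec_inner (B k *v \<xi>) \<xi>)
      + (\<Sum>i\<in>K. sphere_mean (\<lambda>\<xi>. cvec_inner ((B i ** B s) *v \<xi>) \<xi> * (\<Prod>k\<in>K - {i}. cvec_inner (B k *v \<xi>) \<xi>)))"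
proof -
  define q where "q = (\<lambda>(M :: complex ^ 'n ^ 'n) \<xi>. cvec_inner (M *v \<xi>) \<xi>)"
  define A where "A = B s"
  define P :: "'n \<Rightarrow> 'n \<Rightarrow> complex ^ 'n ^ 'n" where "P = (\<lambda>a b. \<chi> i j. if i = b then A $ a $ j else 0)"
  define B' where "B' = (\<lambda>a b. B(s := P a b))"
  define R where "R = (\<lambda>a b \<xi>. \<Sum>i\<in>insert s K.
      (cvec_inner \<xi> (axis b 1) * cvec_inner (B' a b i *v axis a 1) \<xi>
        - cvec_inner (axis a 1) \<xi> * cvec_inner (B' a b i *v \<xi>) (axis b 1))
      * (\<Prod>j\<in>insert s K - {i}. q (B' a b j) \<xi>))"
  \<comment> \<open>Consequently the form of \<open>P a b\<close> at \<open>x\<close> is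
    \<open>(A *v x) $ a * cnj (x $ b)\<close>, a single product of coordinates.\<close>
  have P: "P a b *v x = (A *v x) $ a *s axis b 1" for a b x
    by (simp add: P_def vec_eq_iff matrix_vector_mult_def axis_def)
  have cont: "continuous_on UNIV (q M)" for M unfolding q_def by (intro continuous_intros)
  have int: "integrable normalized_sphere_measure (R a b)" for a b
    unfolding R_def by (intro integrable_normalized_sphere_measure continuous_intros cont)
  \<comment> \<open>The first summand comes from differentiating the adapted factor at
    \<open>s\<close>; in the others that factor survives as
    \<open>(A *v \<xi>) $ a * cnj (\<xi> $ b)\<close> and is distributed over the
    commutator.\<close>
  have R: "R a b \<xi> = (\<xi> $ b * cnj (\<xi> $ b) * A $ a $ a - (A *v \<xi>) $ a * cnj (\<xi> $ a)) * (\<Prod>j\<in>K. q (B j) \<xi>)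
      + (\<Sum>i\<in>K. (\<xi> $ b * cnj (\<xi> $ b) * ((A *v \<xi>) $ a * cvec_inner (B i *v axis a 1) \<xi>)
           - (A *v \<xi>) $ a * cnj (\<xi> $ a) * ((B i *v \<xi>) $ b * cnj (\<xi> $ b)))
         * (\<Prod>j\<in>K - {i}. q (B j) \<xi>))" for a b \<xi>
  proof -
    have prodK: "(\<Prod>j\<in>J. q (B' a b j) \<xi>) = (\<Prod>j\<in>J. q (B j) \<xi>)" if "J \<subseteq> K" for J
      using that s by (intro prod.cong) (auto simp: B'_def)
    have 1: "insert s K - {i} = insert s (K - {i})" if "i \<in> K" for i using that s by auto
    have 2: "(\<Prod>j\<in>insert s K - {i}. q (B' a b j) \<xi>)
        = (A *v \<xi>) $ a * cnj (\<xi> $ b) * (\<Prod>j\<in>K - {i}. q (B j) \<xi>)" if "i \<in> K" for i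
      using K s that
      by (simp add: 1 prodK) (simp add: q_def B'_def P cvec_inner_smult_left cvec_inner_axis_left)
    have 3: "(A *v axis a 1) $ a = A $ a $ a" by (simp add: matrix_vector_mult_axis_nth)
    have 4: "B' a b i = B i" if "i \<in> K" for i using that s by (auto simp: B'_def)
    have 5: "insert s K - {s} = K" using s by auto
    have "R a b \<xi> = (\<xi> $ b * ((A *v axis a 1) $ a * cnj (\<xi> $ b)) - cnj (\<xi> $ a) * (A *v \<xi>) $ a)
          * (\<Prod>j\<in>K. q (B j) \<xi>)
        + (\<Sum>i\<in>K. (\<xi> $ b * cvec_inner (B i *v axis a 1) \<xi> - cnj (\<xi> $ a) * (B i *v \<xi>) $ b)
          * ((A *v \<xi>) $ a * cnj (\<xi> $ b) * (\<Prod>j\<in>K - {i}. q (B j) \<xi>)))"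
      unfolding R_def sum.insert[OF K s] 5
      by (simp add: 2 4 prodK cvec_inner_axis_left cvec_inner_axis_right cong: sum.cong)
         (simp add: B'_def P cvec_inner_smult_left cvec_inner_axis_left axis_nth)
    then show ?thesis by (simp add: 3 algebra_simps)
  qed
  have sum_R: "(\<Sum>a\<in>UNIV. \<Sum>b\<in>UNIV. R a b \<xi>)
      = trace A * (\<Prod>k\<in>K. q (B k) \<xi>) + (\<Sum>i\<in>K. q (B i ** A) \<xi> * (\<Prod>k\<in>K - {i}. q (B k) \<xi>))
        - of_nat (CARD('n) + card K) * (q A \<xi> * (\<Prod>k\<in>K. q (B k) \<xi>))"
    if "norm \<xi> = 1" for \<xi>
  proof -
    have unit: "(\<Sum>b\<in>UNIV. \<xi> $ b * cnj (\<xi> $ b)) = 1"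
      using cvec_inner_self[of \<xi>] that by (simp add: cvec_inner_def)
    have qsum: "(\<Sum>a\<in>UNIV. (M *v \<xi>) $ a * cnj (\<xi> $ a)) = q M \<xi>" for M
      by (simp add: q_def cvec_inner_def)
    have "(\<Sum>a\<in>UNIV. \<Sum>b\<in>UNIV. \<xi> $ b * cnj (\<xi> $ b) * A $ a $ a - (A *v \<xi>) $ a * cnj (\<xi> $ a))
        = trace A - of_nat CARD('n) * q A \<xi>"
      by (simp add: sum_subtractf sum_distrib_right[symmetric] sum_distrib_left[symmetric] unit qsum trace_def)
    moreover have "(\<Sum>a\<in>UNIV. \<Sum>b\<in>UNIV. \<xi> $ b * cnj (\<xi> $ b) * ((A *v \<xi>) $ a * cvec_inner (M *v axis a 1) \<xi>)
           - (A *v \<xi>) $ a * cnj (\<xi> $ a) * ((M *v \<xi>) $ b * cnj (\<xi> $ b)))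
        = q (M ** A) \<xi> - q A \<xi> * q M \<xi>" for M
      by (simp add: sum_subtractf sum_distrib_right[symmetric] sum_distrib_left[symmetric] unit qsum
          sum_cvec_inner_axis)
         (simp add: q_def matrix_vector_mul_assoc)
    ultimately have "(\<Sum>a\<in>UNIV. \<Sum>b\<in>UNIV. R a b \<xi>)
        = (trace A - of_nat CARD('n) * q A \<xi>) * (\<Prod>j\<in>K. q (B j) \<xi>)
          + (\<Sum>i\<in>K. (q (B i ** A) \<xi> - q A \<xi> * q (B i) \<xi>) * (\<Prod>j\<in>K - {i}. q (B j) \<xi>))"
      unfolding R by (simp only: sum.distrib sum.swap[of _ K] sum_distrib_right[symmetric])
    \<comment> \<open>Multiplying \<open>q (B i)\<close> back into the product over
      \<open>K - {i}\<close> restores the full product. The subtracted term is thus the same for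
      every \<open>i\<close>, which accounts for \<open>card K\<close> in the coefficient.\<close>
    also have "(\<Sum>i\<in>K. (q (B i ** A) \<xi> - q A \<xi> * q (B i) \<xi>) * (\<Prod>j\<in>K - {i}. q (B j) \<xi>))
        = (\<Sum>i\<in>K. q (B i ** A) \<xi> * (\<Prod>j\<in>K - {i}. q (B j) \<xi>) - q A \<xi> * (\<Prod>k\<in>K. q (B k) \<xi>))"
      by (intro sum.cong refl) (simp add: prod.remove[OF K] algebra_simps)
    finally show ?thesis by (simp add: sum_subtractf algebra_simps)
  qed
  have "0 = (\<Sum>a\<in>UNIV. \<Sum>b\<in>UNIV. sphere_mean (R a b))"
    unfolding R_def q_def by (simp add: sphere_mean_commutator K)
  also have "\<dots> = sphere_mean (\<lambda>\<xi>. \<Sum>a\<in>UNIV. \<Sum>b\<in>UNIV. R a b \<xi>)"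
    by (simp add: int)
  \<comment> \<open>The contraction \<open>sum_R\<close> holds for unit vectors, and these make up
    the space of the measure.\<close>
  also have "\<dots> = sphere_mean (\<lambda>\<xi>. trace A * (\<Prod>k\<in>K. q (B k) \<xi>)
        + (\<Sum>i\<in>K. q (B i ** A) \<xi> * (\<Prod>k\<in>K - {i}. q (B k) \<xi>))
        - of_nat (CARD('n) + card K) * (q A \<xi> * (\<Prod>k\<in>K. q (B k) \<xi>)))"
    by (intro Bochner_Integration.integral_cong refl sum_R) (simp add: space_normalized_sphere_measure)
  also have "\<dots> = trace A * sphere_mean (\<lambda>\<xi>. \<Prod>k\<in>K. q (B k) \<xi>)
        + (\<Sum>i\<in>K. sphere_mean (\<lambda>\<xi>. q (B i ** A) \<xi> * (\<Prod>k\<in>K - {i}. q (B k) \<xi>)))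
        - of_nat (CARD('n) + card K) * sphere_mean (\<lambda>\<xi>. q A \<xi> * (\<Prod>k\<in>K. q (B k) \<xi>))"
  proof -
    have i1: "integrable normalized_sphere_measure (\<lambda>\<xi>. \<Prod>k\<in>K. q (B k) \<xi>)"
      and i2: "integrable normalized_sphere_measure (\<lambda>\<xi>. q (B i ** A) \<xi> * (\<Prod>k\<in>K - {i}. q (B k) \<xi>))"
      and i3: "integrable normalized_sphere_measure (\<lambda>\<xi>. q A \<xi> * (\<Prod>k\<in>K. q (B k) \<xi>))" for i
      by (intro integrable_normalized_sphere_measure continuous_intros cont)+
    show ?thesis by (simp add: i1 i2 i3 del: of_nat_add)
  qed
  finally show ?thesis
    using K s by (simp add: q_def A_def)
qed

section \<open>Moments up to order four and the trace formula\<close>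

lemma measure_normalized_sphere_measure_space:
  "measure (normalized_sphere_measure :: 'a::euclidean_space measure) (space normalized_sphere_measure) = 1"
  by (simp add: measure_def space_normalized_sphere_measure emeasure_normalized_sphere_measure_total)

theorem theorem4p2:
  fixes A B C D :: "complex ^ 'n ^ 'n"
  shows "of_nat (CARD('n) * (CARD('n) + 1) * (CARD('n) + 2) * (CARD('n) + 3)) *
      (LINT \<xi>|normalized_sphere_measure.
         cvec_inner (A *v \<xi>) \<xi> * cvec_inner (B *v \<xi>) \<xi> *
         cvec_inner (C *v \<xi>) \<xi> * cvec_inner (D *v \<xi>) \<xi>) =
      trace (A ** B ** C ** D + A ** B ** D ** C + A ** C ** B ** D +
             A ** C ** D ** B + A ** D ** B ** C + A ** D ** C ** B) +
      trace A * trace (B ** C ** D + B ** D ** C) +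
      trace B * trace (A ** C ** D + A ** D ** C) +
      trace C * trace (A ** B ** D + A ** D ** B) +
      trace D * trace (A ** B ** C + A ** C ** B) +
      trace (A ** B) * (trace (C ** D) + trace C * trace D) +
      trace (A ** C) * (trace (B ** D) + trace B * trace D) +
      trace (A ** D) * (trace (B ** C) + trace B * trace C) +
      trace A * (trace B * trace (C ** D) + trace C * trace (B ** D) + trace D * trace (B ** C)) +
      trace A * trace B * trace C * trace D"
proof -
  define n :: complex where "n = of_nat CARD('n)"
  define q where "q = (\<lambda>(M :: complex ^ 'n ^ 'n) \<xi>. cvec_inner (M *v \<xi>) \<xi>)"
  \<comment> \<open>With \<open>K\<close> empty the remaining product is 1, whose mean is the total
    mass 1; this starts the recursion.\<close>
  have m1: "n * sphere_mean (q X) = trace X" for X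
    using sphere_mean_recursion[of "{}" "0::nat" "\<lambda>_. X"]
    by (simp add: n_def q_def measure_normalized_sphere_measure_space)
  \<comment> \<open>List indexing names the factors, and index 0 is the one removed. It multiplies
    the others from the right, hence \<open>Y ** X\<close>.\<close>
  have m2: "(n + 1) * sphere_mean (\<lambda>\<xi>. q X \<xi> * q Y \<xi>)
      = trace X * sphere_mean (q Y) + sphere_mean (q (Y ** X))" for X Y
    using sphere_mean_recursion[of "{1}" "0::nat" "(!) [X, Y]"]
    by (simp add: n_def q_def add_ac)
  have m3: "(n + 2) * sphere_mean (\<lambda>\<xi>. q X \<xi> * q Y \<xi> * q Z \<xi>)
      = trace X * sphere_mean (\<lambda>\<xi>. q Y \<xi> * q Z \<xi>)
        + sphere_mean (\<lambda>\<xi>. q (Y ** X) \<xi> * q Z \<xi>) + sphere_mean (\<lambda>\<xi>. q Y \<xi> * q (Z ** X) \<xi>)" for X Y Z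
    using sphere_mean_recursion[of "{1, 2}" "0::nat" "(!) [X, Y, Z]"]
    by (simp add: n_def q_def insert_Diff_if mult_ac add_ac)
  have m4: "(n + 3) * sphere_mean (\<lambda>\<xi>. q A \<xi> * q B \<xi> * q C \<xi> * q D \<xi>)
      = trace A * sphere_mean (\<lambda>\<xi>. q B \<xi> * q C \<xi> * q D \<xi>)
        + sphere_mean (\<lambda>\<xi>. q (B ** A) \<xi> * q C \<xi> * q D \<xi>)
        + sphere_mean (\<lambda>\<xi>. q B \<xi> * q (C ** A) \<xi> * q D \<xi>)
        + sphere_mean (\<lambda>\<xi>. q B \<xi> * q C \<xi> * q (D ** A) \<xi>)"
    using sphere_mean_recursion[of "{1, 2, 3}" "0::nat" "(!) [A, B, C, D]"]
    by (simp add: n_def q_def insert_Diff_if mult_ac add_ac)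
  \<comment> \<open>Trace expressions for the second and third moments, multiplied by
    \<open>n * (n + 1)\<close> and \<open>n * (n + 1) * (n + 2)\<close>; clearing denominators this
    way avoids division.\<close>
  define E2 where "E2 = (\<lambda>X Y. trace X * trace Y + trace (Y ** X :: complex ^ 'n ^ 'n))"
  define E3 where "E3 = (\<lambda>X Y Z. trace X * E2 Y Z + E2 (Y ** X) Z + E2 Y (Z ** X))"
  have e2: "n * (n + 1) * sphere_mean (\<lambda>\<xi>. q X \<xi> * q Y \<xi>) = E2 X Y" for X Y
  proof -
    have "n * (n + 1) * sphere_mean (\<lambda>\<xi>. q X \<xi> * q Y \<xi>)
        = trace X * (n * sphere_mean (q Y)) + n * sphere_mean (q (Y ** X))"
      unfolding mult.assoc m2 by (simp add: algebra_simps)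
    then show ?thesis by (simp only: m1 E2_def)
  qed
  have e3: "n * (n + 1) * (n + 2) * sphere_mean (\<lambda>\<xi>. q X \<xi> * q Y \<xi> * q Z \<xi>) = E3 X Y Z" for X Y Z
  proof -
    have "n * (n + 1) * (n + 2) * sphere_mean (\<lambda>\<xi>. q X \<xi> * q Y \<xi> * q Z \<xi>)
        = n * (n + 1) * (trace X * sphere_mean (\<lambda>\<xi>. q Y \<xi> * q Z \<xi>)
        + sphere_mean (\<lambda>\<xi>. q (Y ** X) \<xi> * q Z \<xi>) + sphere_mean (\<lambda>\<xi>. q Y \<xi> * q (Z ** X) \<xi>))"
      unfolding m3[symmetric] by (simp only: mult.assoc)
    also have "\<dots> = trace X * (n * (n + 1) * sphere_mean (\<lambda>\<xi>. q Y \<xi> * q Z \<xi>))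
        + n * (n + 1) * sphere_mean (\<lambda>\<xi>. q (Y ** X) \<xi> * q Z \<xi>)
        + n * (n + 1) * sphere_mean (\<lambda>\<xi>. q Y \<xi> * q (Z ** X) \<xi>)"
      by (simp only: distrib_left mult_ac)
    finally show ?thesis by (simp only: e2 E3_def)
  qed
  have "n * (n + 1) * (n + 2) * (n + 3) * sphere_mean (\<lambda>\<xi>. q A \<xi> * q B \<xi> * q C \<xi> * q D \<xi>)
      = n * (n + 1) * (n + 2) * (trace A * sphere_mean (\<lambda>\<xi>. q B \<xi> * q C \<xi> * q D \<xi>)
        + sphere_mean (\<lambda>\<xi>. q (B ** A) \<xi> * q C \<xi> * q D \<xi>)
        + sphere_mean (\<lambda>\<xi>. q B \<xi> * q (C ** A) \<xi> * q D \<xi>)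
        + sphere_mean (\<lambda>\<xi>. q B \<xi> * q C \<xi> * q (D ** A) \<xi>))"
    unfolding m4[symmetric] by (simp only: mult.assoc)
  also have "\<dots> = trace A * (n * (n + 1) * (n + 2) * sphere_mean (\<lambda>\<xi>. q B \<xi> * q C \<xi> * q D \<xi>))
        + n * (n + 1) * (n + 2) * sphere_mean (\<lambda>\<xi>. q (B ** A) \<xi> * q C \<xi> * q D \<xi>)
        + n * (n + 1) * (n + 2) * sphere_mean (\<lambda>\<xi>. q B \<xi> * q (C ** A) \<xi> * q D \<xi>)
        + n * (n + 1) * (n + 2) * sphere_mean (\<lambda>\<xi>. q B \<xi> * q C \<xi> * q (D ** A) \<xi>)"
    by (simp only: distrib_left mult_ac)
  finally have main: "n * (n + 1) * (n + 2) * (n + 3) * sphere_mean (\<lambda>\<xi>. q A \<xi> * q B \<xi> * q C \<xi> * q D \<xi>)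
      = trace A * E3 B C D + E3 (B ** A) C D + E3 B (C ** A) D + E3 B C (D ** A)"
    by (simp only: e3)
  have n: "of_nat (CARD('n) * (CARD('n) + 1) * (CARD('n) + 2) * (CARD('n) + 3)) = n * (n + 1) * (n + 2) * (n + 3)"
    by (simp only: n_def of_nat_mult of_nat_add of_nat_1 of_nat_numeral)
  \<comment> \<open>Each trace containing \<open>A\<close> is rotated until \<open>A\<close> stands
    first; \<open>X\<close> absorbs whatever precedes \<open>A\<close>.\<close>
  have cycle: "trace (X ** A) = trace (A ** X)" "trace (X ** A ** Y) = trace (A ** Y ** X)"
      "trace (X ** A ** Y ** Z) = trace (A ** Y ** Z ** X)" for X Y Z
    using trace_mul_sym[of X A] trace_mul_sym[of X "A ** Y"] trace_mul_sym[of X "A ** Y ** Z"]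
    by (simp_all only: matrix_mul_assoc)
  \<comment> \<open>The traces without \<open>A\<close> are brought to the representatives that
    occur in the claim.\<close>
  have cycle': "trace (C ** B) = trace (B ** C)" "trace (D ** B) = trace (B ** D)"
      "trace (D ** C) = trace (C ** D)" "trace (D ** C ** B) = trace (B ** D ** C)"
      "trace (D ** B ** C) = trace (B ** C ** D)"
    using trace_mul_sym[of C B] trace_mul_sym[of D B] trace_mul_sym[of D C]
      trace_mul_sym[of "D ** C" B] trace_mul_sym[of D "B ** C"]
    by (simp_all only: matrix_mul_assoc)
  show ?thesis
    unfolding n main[unfolded q_def]
    unfolding E3_def E2_def trace_add matrix_mul_assoc cycle cycle' by (simp add: algebra_simps)
qed

end
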